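(* Let $\mu$ be an admissible probability measure on $\mathbb{R}$. Then $\Lambda(\mu)$ is a semigroup under addition (i.e. $s,t\in\Lambda(\mu)$ implies $s+t\in\Lambda(\mu)$) containing $1$. Furthermore, $\Lambda(\mu)$ is closed in $(0,\infty)$.
   Context: A characteristic function is a function $f:\mathbb{R}\to\mathbb{C}$ that is continuous, positive-definite, and satisfies $f(0)=1$; by Bochner's theorem these are exactly the Fourier transforms $\hat\mu(y)=\int_{\mathbb{R}}e^{iyx}\,\mu(dx)$ of probability measures $\mu$ on $\mathbb{R}$. A probability measure $\mu$ on $\mathbb{R}$ is called admissible if $\hat\mu(y)\neq 0$ for all $y\in\mathbb{R}$. For an admissible $\mu$ there is a unique continuous function $\psi:\mathbb{R}\to\mathbb{C}$ with $\psi(0)=0$ and $\hat\mu=e^{\psi}$, called the second characteristic of $\mu$. For an admissible $\mu$ with second characteristic $\psi$ one sets $\Lambda(\mu):=\{t>0 : e^{t\psi}\text{ is a characteristic function}\}$. *)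

theory Defs
  imports "HOL-Probability.Probability"
begin

text \<open>
  Probability measures on the real line are rendered by \<^locale>\<open>real_distribution\<close>, and the Fourier
  transform of such a measure is the library's \<^const>\<open>char\<close>.
\<close>

definition positive_definite_fun :: "(real \<Rightarrow> complex) \<Rightarrow> bool" where
  "positive_definite_fun f \<longleftrightarrow>
     (\<forall>(n::nat) (x :: nat \<Rightarrow> real) (c :: nat \<Rightarrow> complex).
        (\<Sum>i<n. \<Sum>j<n. c i * cnj (c j) * f (x i - x j)) \<in> \<real>\<^sub>\<ge>\<^sub>0)"

definition characteristic_fun :: "(real \<Rightarrow> complex) \<Rightarrow> bool" where
  "characteristic_fun f \<longleftrightarrow> continuous_on UNIV f \<and> positive_definite_fun f \<and> f 0 = 1"

definition admissible :: "real measure \<Rightarrow> bool" where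
  "admissible M \<longleftrightarrow> (\<forall>y. char M y \<noteq> 0)"

definition is_second_char :: "real measure \<Rightarrow> (real \<Rightarrow> complex) \<Rightarrow> bool" where
  "is_second_char M \<psi> \<longleftrightarrow>
     continuous_on UNIV \<psi> \<and> \<psi> 0 = 0 \<and> (\<forall>y. char M y = exp (\<psi> y))"

text \<open>Meaningful only for an admissible \<^locale>\<open>real_distribution\<close>; see \<open>ex1_second_char\<close>.\<close>

definition second_char :: "real measure \<Rightarrow> real \<Rightarrow> complex" where
  "second_char M = (THE \<psi>. is_second_char M \<psi>)"

definition Lambda :: "real measure \<Rightarrow> real set" where
  "Lambda M = {t. t > 0 \<and> characteristic_fun (\<lambda>y. exp (of_real t * second_char M y))}"

lemma ex1_second_char:
  assumes "real_distribution M" and "admissible M"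
  shows "\<exists>!\<psi>. is_second_char M \<psi>"
proof (rule ex_ex1I)
  interpret real_distribution M by fact
  have cont: "continuous_on UNIV (char M)"
    by (simp add: continuous_at_imp_continuous_on isCont_char)
  obtain g where g: "continuous_on UNIV g" "\<And>y. char M y = exp (g y)"
    using continuous_logarithm_on_contractible[OF cont] assms(2)
    by (auto simp: admissible_def convex_imp_contractible)
  have "exp (g 0) = 1"
    using g(2)[of 0] char_zero by simp
  then have "is_second_char M (\<lambda>y. g y - g 0)"
    using g by (auto simp: is_second_char_def exp_diff intro!: continuous_intros)
  then show "\<exists>\<psi>. is_second_char M \<psi>" by blast
next
  fix \<psi> \<phi> assume \<psi>: "is_second_char M \<psi>" and \<phi>: "is_second_char M \<phi>"
  define h where "h y = \<psi> y - \<phi> y" for y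
  have cont: "continuous_on UNIV h"
    using \<psi> \<phi> unfolding h_def is_second_char_def by (intro continuous_intros) auto
  have exp_h: "exp (h y) = 1" for y
    using \<psi> \<phi> by (auto simp: h_def is_second_char_def exp_diff)
  have "h constant_on UNIV"
  proof (rule continuous_discrete_range_constant[OF connected_UNIV cont])
    fix x :: real
    have "2 * pi \<le> norm (h y - h x)" if "h y \<noteq> h x" for y
    proof -
      have "exp (h y) = exp (h x)" by (simp add: exp_h)
      then obtain n :: int where n: "h y = h x + (of_int (2 * n) * pi) * \<i>"
        by (auto simp: exp_eq)
      with that have "n \<noteq> 0" by auto
      then have "1 \<le> \<bar>real_of_int n\<bar>" by linarith
      with n show ?thesis by (simp add: norm_mult)
    qed
    then show "\<exists>e>0. \<forall>y. y \<in> UNIV \<and> h y \<noteq> h x \<longrightarrow> e \<le> norm (h y - h x)"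
      using pi_gt_zero by (intro exI[of _ "2 * pi"]) auto
  qed
  then have "h y = h 0" for y
    by (auto simp: constant_on_def)
  then show "\<psi> = \<phi>"
    using \<psi> \<phi> by (auto simp: h_def is_second_char_def fun_eq_iff)
qed

end

theory Submission
  imports Defs
begin

text \<open>
  Write \<open>\<psi>\<close> for the second characteristic of \<open>\<mu>\<close>. Since \<open>\<psi>\<close> is continuous and vanishes at \<open>0\<close>, the
  function \<open>exp (t \<psi>)\<close> is always continuous with value \<open>1\<close> at \<open>0\<close>, so membership of \<open>t > 0\<close> in
  \<open>Lambda \<mu>\<close> only depends on positive definiteness (\<open>mem_Lambda_iff\<close>).

  Closure under addition holds because \<open>exp ((s + t) \<psi>)\<close> is the product of \<open>exp (s \<psi>)\<close> and
  \<open>exp (t \<psi>)\<close>, and a product of positive definite functions is positive definite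
  (\<open>positive_definite_fun_mult\<close>). This is the Schur product theorem for finite matrices
  (\<open>psd_on_Schur_product\<close>), proved by splitting off rank-one matrices with one step of the
  Cholesky decomposition at a time.
  The number \<open>1\<close> is a member because Fourier transforms of probability measures are positive
  definite (\<open>positive_definite_char\<close>). Finally, each of the conditions that make up positive
  definiteness of \<open>exp (t \<psi>)\<close> is a closed condition on \<open>t\<close>.
\<close>

section \<open>Positive semidefinite matrices and the Schur product\<close>

text \<open>
  Positive semidefiniteness of the complex matrix \<open>A\<close> with rows and columns indexed by \<open>I\<close>. That
  \<open>A\<close> is Hermitian is not required: it follows, since the quadratic form is real for all complex
  vectors.
\<close>

definition psd_on :: "'a set \<Rightarrow> ('a \<Rightarrow> 'a \<Rightarrow> complex) \<Rightarrow> bool" where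
  "psd_on I A \<longleftrightarrow> (\<forall>c. (\<Sum>i\<in>I. \<Sum>j\<in>I. c i * cnj (c j) * A i j) \<in> \<real>\<^sub>\<ge>\<^sub>0)"

lemma psd_on_two_points:
  assumes "psd_on I A" "finite I" "i \<in> I" "j \<in> I" "i \<noteq> j"
  shows "p * cnj p * A i i + p * cnj q * A i j + q * cnj p * A j i + q * cnj q * A j j \<in> \<real>\<^sub>\<ge>\<^sub>0"
proof -
  define c where "c k = (if k = i then p else if k = j then q else 0)" for k
  have inner: "(\<Sum>l\<in>I. c k * cnj (c l) * A k l) = (\<Sum>l\<in>{i, j}. c k * cnj (c l) * A k l)" for k
    using assms by (intro sum.mono_neutral_right) (auto simp: c_def)
  have "(\<Sum>k\<in>I. \<Sum>l\<in>I. c k * cnj (c l) * A k l) = (\<Sum>k\<in>{i, j}. \<Sum>l\<in>{i, j}. c k * cnj (c l) * A k l)"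
    unfolding inner using assms by (intro sum.mono_neutral_right) (auto simp: c_def)
  also have "\<dots> = p * cnj p * A i i + p * cnj q * A i j + q * cnj p * A j i + q * cnj q * A j j"
    using assms(5) by (simp add: c_def)
  finally show ?thesis
    using assms(1)[unfolded psd_on_def, rule_format, of c] by (simp only:)
qed

lemma psd_on_diag:
  assumes "psd_on I A" "finite I" "i \<in> I"
  shows "A i i \<in> \<real>\<^sub>\<ge>\<^sub>0"
proof -
  define c where "c k = (if k = i then 1 else 0 :: complex)" for k
  have "(\<Sum>k\<in>I. \<Sum>l\<in>I. c k * cnj (c l) * A k l) = (\<Sum>k\<in>I. if k = i then A i i else 0)"
  proof (intro sum.cong refl)
    fix k
    have "(\<Sum>l\<in>I. c k * cnj (c l) * A k l) = (\<Sum>l\<in>{i}. c k * cnj (c l) * A k l)"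
      using assms by (intro sum.mono_neutral_right) (auto simp: c_def)
    then show "(\<Sum>l\<in>I. c k * cnj (c l) * A k l) = (if k = i then A i i else 0)"
      by (simp add: c_def)
  qed
  also have "\<dots> = A i i"
    using assms by simp
  finally show ?thesis
    using assms(1)[unfolded psd_on_def, rule_format, of c] by (simp only:)
qed

lemma psd_on_hermitian:
  assumes "psd_on I A" "finite I" "i \<in> I" "j \<in> I"
  shows "A j i = cnj (A i j)"
proof (cases "i = j")
  case True
  then show ?thesis
    using psd_on_diag[OF assms(1-3)] by (auto simp: complex_nonneg_Reals_iff complex_eq_iff)
next
  case False
  note diag = psd_on_diag[OF assms(1,2,3)] psd_on_diag[OF assms(1,2,4)]
  \<comment> \<open>The form is real at the vectors \<open>(1, 1)\<close> and \<open>(1, \<i>)\<close>; this gives the imaginary and the real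
    part of the claim.\<close>
  show ?thesis
    using psd_on_two_points[OF assms False, of 1 1] psd_on_two_points[OF assms False, of 1 "\<i>"] diag
    by (auto simp: complex_nonneg_Reals_iff complex_eq_iff)
qed

lemma psd_on_zero_diag:
  assumes "psd_on I A" "finite I" "i \<in> I" "j \<in> I" "A i i = 0"
  shows "A i j = 0"
proof (cases "i = j")
  case False
  define r where "r = Re (A j j)"
  have herm: "A j i = cnj (A i j)"
    using psd_on_hermitian[OF assms(1-4)] .
  have rj: "A j j = of_real r"
    using psd_on_diag[OF assms(1,2,4)] by (auto simp: complex_nonneg_Reals_iff complex_eq_iff r_def)
  have r0: "0 \<le> r"
    using psd_on_diag[OF assms(1,2,4)] by (auto simp: complex_nonneg_Reals_iff r_def)
  show ?thesis
  proof (rule ccontr)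
    assume nz: "A i j \<noteq> 0"
    \<comment> \<open>As the diagonal entry at \<open>i\<close> vanishes, the form is affine in the coordinate at \<open>i\<close>; this
      value of the coordinate makes the form equal to \<open>- r - 2\<close>.\<close>
    define p where "p = - of_real (r + 1) / A i j"
    have p1: "p * A i j = - of_real (r + 1)"
      using nz by (simp add: p_def)
    have p2: "cnj p * cnj (A i j) = - of_real (r + 1)"
      unfolding complex_cnj_mult[symmetric] p1 by simp
    have "p * cnj p * A i i + p * cnj 1 * A i j + 1 * cnj p * A j i + 1 * cnj 1 * A j j \<in> \<real>\<^sub>\<ge>\<^sub>0"
      by (rule psd_on_two_points[OF assms(1-4) False])
    then have "of_real (- r - 2) \<in> (\<real>\<^sub>\<ge>\<^sub>0 :: complex set)"
      by (simp add: assms(5) herm rj p1 p2)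
    then show False
      using r0 by (simp add: complex_nonneg_Reals_iff)
  qed
qed (use assms in simp)

text \<open>
  One step of the Cholesky decomposition: subtracting the rank-one matrix built from the column of
  the pivot \<open>k\<close> leaves a positive semidefinite matrix on the remaining indices. If the pivot entry is
  zero, the convention \<open>x / 0 = 0\<close> makes the subtracted matrix vanish, so no case distinction is
  needed in the statement.
\<close>

lemma psd_on_Schur_complement:
  assumes psd: "psd_on (insert k I) A" and fin: "finite I" and k: "k \<notin> I"
  shows "psd_on I (\<lambda>i j. A i j - A i k * cnj (A j k) / A k k)"
  unfolding psd_on_def
proof
  fix c :: "'a \<Rightarrow> complex"
  define a where "a = A k k"
  define S where "S = (\<Sum>i\<in>I. c i * A i k)"
  \<comment> \<open>This extension of \<open>c\<close> to the pivot minimizes the quadratic form.\<close>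
  define d where "d i = (if i = k then - (S / a) else c i)" for i
  define Q where "Q = (\<Sum>i\<in>I. \<Sum>j\<in>I. c i * cnj (c j) * A i j)"
  have fin': "finite (insert k I)" using fin by simp
  have a_real: "cnj a = a"
    using psd_on_hermitian[OF psd fin', of k k] by (simp add: a_def)
  have herm: "A k j = cnj (A j k)" if "j \<in> I" for j
    using psd_on_hermitian[OF psd fin', of j k] that by simp
  have dI: "d i = c i" if "i \<in> I" for i
    using that k by (auto simp: d_def)
  have cnjS: "(\<Sum>j\<in>I. cnj (c j) * A k j) = cnj S"
    unfolding S_def by (simp add: herm)
  have row: "(\<Sum>j\<in>I. d k * cnj (c j) * A k j) = d k * cnj S"
    unfolding cnjS[symmetric] sum_distrib_left by (simp add: mult_ac)
  have col: "(\<Sum>i\<in>I. c i * cnj (d k) * A i k) = cnj (d k) * S"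
    unfolding S_def sum_distrib_left by (simp add: mult_ac)
  have "(\<Sum>i\<in>insert k I. \<Sum>j\<in>insert k I. d i * cnj (d j) * A i j)
      = d k * cnj (d k) * a + d k * cnj S + (cnj (d k) * S + Q)"
    using fin k by (simp add: sum.distrib row col a_def Q_def dI)
  also have "\<dots> = Q - S * cnj S / a"
    by (cases "a = 0") (simp_all add: d_def a_real)
  also have "\<dots> = (\<Sum>i\<in>I. \<Sum>j\<in>I. c i * cnj (c j) * (A i j - A i k * cnj (A j k) / A k k))"
    unfolding Q_def S_def cnj_sum sum_product sum_divide_distrib sum_subtractf[symmetric] a_def
    by (intro sum.cong refl) (simp add: algebra_simps)
  finally show "(\<Sum>i\<in>I. \<Sum>j\<in>I. c i * cnj (c j) * (A i j - A i k * cnj (A j k) / A k k)) \<in> \<real>\<^sub>\<ge>\<^sub>0"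
    using psd[unfolded psd_on_def, rule_format, of d] by (simp only:)
qed

text \<open>
  The Schur product theorem, by induction on the index set: \<open>A\<close> is the sum of its Schur complement
  \<open>A'\<close>, whose pivot row and column vanish, and of a rank-one matrix. The entrywise product of \<open>B\<close>
  with the former is handled by the induction hypothesis; the product with the latter amounts to
  rescaling the argument of the quadratic form of \<open>B\<close> and dividing by the nonnegative pivot entry.
\<close>

theorem psd_on_Schur_product:
  assumes "finite I" "psd_on I A" "psd_on I B"
  shows "psd_on I (\<lambda>i j. A i j * B i j)"
  using assms
proof (induction I arbitrary: A rule: finite_induct)
  case empty
  then show ?case by (simp add: psd_on_def)
next
  case (insert k I)
  note fin' = finite.insertI[OF insert.hyps(1), of k]
  define a where "a = A k k"
  define A' where "A' i j = A i j - A i k * cnj (A j k) / a" for i j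
  have B: "psd_on I B"
    unfolding psd_on_def
  proof
    fix c :: "'a \<Rightarrow> complex"
    define d where "d i = (if i = k then 0 else c i)" for i
    have dI: "d i = c i" if "i \<in> I" for i
      using that insert.hyps by (auto simp: d_def)
    have "(\<Sum>i\<in>insert k I. \<Sum>j\<in>insert k I. d i * cnj (d j) * B i j)
        = (\<Sum>i\<in>I. \<Sum>j\<in>I. c i * cnj (c j) * B i j)"
      using insert.hyps by (simp add: dI) (simp add: d_def)
    then show "(\<Sum>i\<in>I. \<Sum>j\<in>I. c i * cnj (c j) * B i j) \<in> \<real>\<^sub>\<ge>\<^sub>0"
      using insert.prems(2)[unfolded psd_on_def, rule_format, of d] by (simp only:)
  qed
  have "psd_on I A'"
    using psd_on_Schur_complement[OF insert.prems(1) insert.hyps] unfolding A'_def a_def .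
  then have IH: "psd_on I (\<lambda>i j. A' i j * B i j)"
    using insert.IH B by blast
  have a_nn: "a \<in> \<real>\<^sub>\<ge>\<^sub>0"
    using psd_on_diag[OF insert.prems(1) fin'] by (simp add: a_def)
  have a_real: "cnj a = a"
    using a_nn by (auto simp: complex_nonneg_Reals_iff complex_eq_iff)
  have row0: "A' k j = 0" if "j \<in> insert k I" for j
  proof (cases "a = 0")
    case True
    then show ?thesis
      using psd_on_zero_diag[OF insert.prems(1) fin' _ that] by (simp add: A'_def a_def)
  next
    case False
    then show ?thesis
      using psd_on_hermitian[OF insert.prems(1) fin' that, of k] by (simp add: A'_def flip: a_def)
  qed
  have col0: "A' i k = 0" if "i \<in> insert k I" for i
  proof (cases "a = 0")
    case True
    then have "A k i = 0"
      using psd_on_zero_diag[OF insert.prems(1) fin' _ that] by (simp add: a_def)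
    then have "A i k = 0"
      using psd_on_hermitian[OF insert.prems(1) fin' _ that, of k] by simp
    then show ?thesis by (simp add: A'_def)
  next
    case False
    then show ?thesis
      by (simp add: A'_def a_real flip: a_def)
  qed
  show ?case
    unfolding psd_on_def
  proof
    fix c :: "'a \<Rightarrow> complex"
    define Q1 where "Q1 = (\<Sum>i\<in>I. \<Sum>j\<in>I. c i * cnj (c j) * (A' i j * B i j))"
    define Q2 where "Q2 = (\<Sum>i\<in>insert k I. \<Sum>j\<in>insert k I.
      (c i * A i k) * cnj (c j * A j k) * B i j)"
    have "(\<Sum>i\<in>insert k I. \<Sum>j\<in>insert k I. c i * cnj (c j) * (A i j * B i j))
        = (\<Sum>i\<in>insert k I. \<Sum>j\<in>insert k I. c i * cnj (c j) * (A' i j * B i j)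
            + (c i * A i k) * cnj (c j * A j k) * B i j / a)"
      by (intro sum.cong refl) (simp add: A'_def field_simps)
    also have "\<dots> = (\<Sum>i\<in>insert k I. \<Sum>j\<in>insert k I. c i * cnj (c j) * (A' i j * B i j)) + Q2 / a"
      unfolding Q2_def sum.distrib sum_divide_distrib ..
    also have "(\<Sum>i\<in>insert k I. \<Sum>j\<in>insert k I. c i * cnj (c j) * (A' i j * B i j)) = Q1"
      using insert.hyps by (simp add: row0 col0 Q1_def)
    finally have eq: "(\<Sum>i\<in>insert k I. \<Sum>j\<in>insert k I. c i * cnj (c j) * (A i j * B i j))
      = Q1 + Q2 / a" .
    have "Q1 \<in> \<real>\<^sub>\<ge>\<^sub>0"
      using IH unfolding psd_on_def Q1_def by blast
    moreover have "Q2 \<in> \<real>\<^sub>\<ge>\<^sub>0"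
      using insert.prems(2)[unfolded psd_on_def, rule_format, of "\<lambda>i. c i * A i k"]
      unfolding Q2_def .
    ultimately show "(\<Sum>i\<in>insert k I. \<Sum>j\<in>insert k I. c i * cnj (c j) * (A i j * B i j)) \<in> \<real>\<^sub>\<ge>\<^sub>0"
      unfolding eq using a_nn
      by (intro nonneg_Reals_add_I nonneg_Reals_divide_I)
  qed
qed

section \<open>Positive definite functions\<close>

lemma positive_definite_fun_iff_psd_on:
  "positive_definite_fun f \<longleftrightarrow> (\<forall>(n::nat) x. psd_on {..<n} (\<lambda>i j. f (x i - x j)))"
  by (simp add: positive_definite_fun_def psd_on_def)

lemma positive_definite_fun_mult:
  assumes "positive_definite_fun f" "positive_definite_fun g"
  shows "positive_definite_fun (\<lambda>y. f y * g y)"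
  using assms psd_on_Schur_product[OF finite_lessThan]
  unfolding positive_definite_fun_iff_psd_on by blast

text \<open>The quadratic form is the integral of the squared modulus of a trigonometric polynomial.\<close>

lemma (in real_distribution) positive_definite_char: "positive_definite_fun (char M)"
  unfolding positive_definite_fun_def
proof (intro allI)
  fix n :: nat and x :: "nat \<Rightarrow> real" and c :: "nat \<Rightarrow> complex"
  define g where "g t = (\<Sum>i<n. c i * iexp (x i * t))" for t :: real
  have int: "integrable M (\<lambda>t. iexp (y * t))" for y :: real
    by (rule integrable_const_bound[where B = 1]) auto
  have iexp_diff: "iexp (a * t) * cnj (iexp (b * t)) = iexp ((a - b) * t)" for a b t :: real
    by (simp add: exp_cnj exp_add[symmetric] algebra_simps)
  have norm_g: "complex_of_real ((cmod (g t))\<^sup>2) = (\<Sum>i<n. \<Sum>j<n. c i * cnj (c j) * iexp ((x i - x j) * t))" for t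
    unfolding complex_norm_square g_def cnj_sum sum_product iexp_diff[symmetric] complex_cnj_mult
    by (simp only: mult_ac)
  have "(CLINT t|M. complex_of_real ((cmod (g t))\<^sup>2))
      = (\<Sum>i<n. \<Sum>j<n. c i * cnj (c j) * char M (x i - x j))"
    unfolding norm_g char_def
    by (simp only: Bochner_Integration.integral_sum Bochner_Integration.integrable_sum
        integrable_mult_right integral_mult_right_zero int)
  then have "(\<Sum>i<n. \<Sum>j<n. c i * cnj (c j) * char M (x i - x j))
      = complex_of_real (LINT t|M. (cmod (g t))\<^sup>2)"
    by (simp only: integral_complex_of_real)
  then show "(\<Sum>i<n. \<Sum>j<n. c i * cnj (c j) * char M (x i - x j)) \<in> \<real>\<^sub>\<ge>\<^sub>0"
    by (simp add: complex_nonneg_Reals_iff)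
qed

section \<open>Convolution powers of an admissible distribution\<close>

lemma is_second_char_second_char:
  assumes "real_distribution M" and "admissible M"
  shows "is_second_char M (second_char M)"
  unfolding second_char_def using ex1_second_char[OF assms] by (rule theI')

lemma mem_Lambda_iff:
  assumes "real_distribution M" and "admissible M"
  shows "t \<in> Lambda M \<longleftrightarrow> 0 < t \<and> positive_definite_fun (\<lambda>y. exp (of_real t * second_char M y))"
proof -
  have "continuous_on UNIV (second_char M)" "second_char M 0 = 0"
    using is_second_char_second_char[OF assms] by (auto simp: is_second_char_def)
  then show ?thesis
    by (auto simp: Lambda_def characteristic_fun_def intro!: continuous_intros)
qed

text \<open>Each value of the quadratic form is continuous in \<open>t\<close>, for a fixed vector and fixed points.\<close>

lemma closed_positive_definite_exp:
  "closed {t. positive_definite_fun (\<lambda>y. exp (of_real t * \<psi> y))}"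
  unfolding positive_definite_fun_def
  by (intro closed_Collect_all closed_vimage[OF closed_nonneg_Reals_complex, unfolded vimage_def]
      continuous_intros)

theorem proposition2p1:
  fixes \<mu> :: "real measure"
  assumes "real_distribution \<mu>" and "admissible \<mu>"
  shows "(\<forall>s\<in>Lambda \<mu>. \<forall>t\<in>Lambda \<mu>. s + t \<in> Lambda \<mu>)
       \<and> 1 \<in> Lambda \<mu>
       \<and> closedin (top_of_set {0<..}) (Lambda \<mu>)"
proof (intro conjI ballI)
  note mem = mem_Lambda_iff[OF assms]
  show "s + t \<in> Lambda \<mu>" if "s \<in> Lambda \<mu>" "t \<in> Lambda \<mu>" for s t
    using that positive_definite_fun_mult unfolding mem by (simp add: distrib_right exp_add)
  have "char \<mu> = (\<lambda>y. exp (second_char \<mu> y))"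
    using is_second_char_second_char[OF assms] by (auto simp: is_second_char_def)
  then show "1 \<in> Lambda \<mu>"
    using real_distribution.positive_definite_char[OF assms(1)] by (simp add: mem)
  have "Lambda \<mu> = {0<..} \<inter> {t. positive_definite_fun (\<lambda>y. exp (of_real t * second_char \<mu> y))}"
    by (auto simp: mem)
  then show "closedin (top_of_set {0<..}) (Lambda \<mu>)"
    using closed_positive_definite_exp by (auto simp: closedin_closed)
qed

end
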